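(* Let $A\in\mathbb{R}^{n\times n}$ be a symmetric positive definite matrix and let $B\in\mathbb{R}^{m\times n}$ and $C\in\mathbb{R}^{p\times m}$ be full row rank matrices. Let $\alpha>0$, let $\mathcal{P}_{SS}$ be the shift-splitting preconditioner with parameter $\alpha$, let $\lambda$ be a non-real eigenvalue of the SS preconditioned matrix $\mathcal{P}_{SS}^{-1}\mathcal{A}$, i.e. $\Im(\lambda)\neq0$, and let ${\bf p}=[u^T,v^T,w^T]^T$ be a corresponding eigenvector (with $u\in\mathbb{C}^n$, $v\in\mathbb{C}^m$, $w\in\mathbb{C}^p$). Then: (1) If $Cv=0$, $\lambda$ satisfies $$\frac{2\kappa_{\min}}{2\alpha+\kappa_{\min}}\leq|\lambda|\leq\sqrt{\frac{4\tau_{\max}}{\alpha^2+\alpha\kappa_{\min}+\tau_{\max}}}.$$ (2) If $Cv\neq0$, the real and imaginary parts of $\lambda/(2-\lambda)$ satisfy $$\frac{\kappa_{\min}\,\tau_{\min}}{2\alpha\left(\kappa_{\max}^2+\tau_{\max}+\beta_{\max}\right)}\leq\Re\left(\frac{\lambda}{2-\lambda}\right)\leq\frac{\kappa_{\max}}{2\alpha}\quad\text{and}\quad\left|\Im\left(\frac{\lambda}{2-\lambda}\right)\right|\leq\frac{\sqrt{\tau_{\max}+\beta_{\max}}}{\alpha}.$$ Here $\kappa_{\min}=\lambda_{\min}(A)$, $\kappa_{\max}=\lambda_{\max}(A)$, $\tau_{\max}=\lambda_{\max}(BB^T)$, $\tau_{\min}=\lambda_{\min}(BB^T)$ and $\b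eta_{\max}=\lambda_{\max}(C^TC)$.
   Context: The saddle point matrix is $\mathcal{A}=\begin{bmatrix}A&B^T&0\\-B&0&-C^T\\0&C&0\end{bmatrix}$. The shift-splitting (SS) preconditioner is $$\mathcal{P}_{SS}=\frac12\begin{bmatrix}\alpha I+A&B^T&0\\-B&\alpha I&-C^T\\0&C&\alpha I\end{bmatrix},$$ where $I$ denotes identity matrices of appropriate sizes. $\lambda_{\max}(\cdot)$ and $\lambda_{\min}(\cdot)$ denote the maximum and minimum eigenvalues of a matrix with real eigenvalues. *)

theory Defs
  imports "HOL-Analysis.Analysis"
begin

definition sym_pos_def :: "real^'n^'n \<Rightarrow> bool" where
  "sym_pos_def A \<longleftrightarrow> transpose A = A \<and> (\<forall>x. x \<noteq> 0 \<longrightarrow> x \<bullet> (A *v x) > 0)"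

definition eigenvector :: "'a::field^'n^'n \<Rightarrow> 'a^'n \<Rightarrow> 'a \<Rightarrow> bool" where
  "eigenvector M x k \<longleftrightarrow> x \<noteq> 0 \<and> M *v x = k *s x"

definition eigenvalue :: "'a::field^'n^'n \<Rightarrow> 'a \<Rightarrow> bool" where
  "eigenvalue M k \<longleftrightarrow> (\<exists>x. eigenvector M x k)"

(* Meant for matrices all of whose eigenvalues are real (e.g. symmetric ones), for which the set of
   real eigenvalues is the nonempty finite set of all eigenvalues. *)
definition lambda_max :: "real^'n^'n \<Rightarrow> real" where
  "lambda_max M = Max {k. eigenvalue M k}"

definition lambda_min :: "real^'n^'n \<Rightarrow> real" where
  "lambda_min M = Min {k. eigenvalue M k}"

(* Block sizes are carried by the index types: block rows and block columns of sizes n, m, p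
   correspond to the three summands of 'n + 'm + 'p. *)
definition block_vector :: "'a^'n \<Rightarrow> 'a^'m \<Rightarrow> 'a^'p \<Rightarrow> 'a^('n + 'm + 'p)" where
  "block_vector u v w =
     (\<chi> i. case i of Inl a \<Rightarrow> u $ a | Inr (Inl b) \<Rightarrow> v $ b | Inr (Inr c) \<Rightarrow> w $ c)"

definition block_matrix ::
  "'a^'n^'n \<Rightarrow> 'a^'m^'n \<Rightarrow> 'a^'p^'n \<Rightarrow>
   'a^'n^'m \<Rightarrow> 'a^'m^'m \<Rightarrow> 'a^'p^'m \<Rightarrow>
   'a^'n^'p \<Rightarrow> 'a^'m^'p \<Rightarrow> 'a^'p^'p \<Rightarrow> 'a^('n + 'm + 'p)^('n + 'm + 'p)" where
  "block_matrix M11 M12 M13 M21 M22 M23 M31 M32 M33 =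
     (\<chi> i. case i of
         Inl a \<Rightarrow> block_vector (M11 $ a) (M12 $ a) (M13 $ a)
       | Inr (Inl b) \<Rightarrow> block_vector (M21 $ b) (M22 $ b) (M23 $ b)
       | Inr (Inr c) \<Rightarrow> block_vector (M31 $ c) (M32 $ c) (M33 $ c))"

definition saddle_matrix ::
  "real^'n^'n \<Rightarrow> real^'n^'m \<Rightarrow> real^'m^'p \<Rightarrow> real^('n + 'm + 'p)^('n + 'm + 'p)" where
  "saddle_matrix A B C = block_matrix
       A     (transpose B) 0
     (- B)   0             (- transpose C)
       0     C             0"

(* The library's "mat \<alpha>" is \<alpha> times the identity matrix. *)
definition P_SS ::
  "real \<Rightarrow> real^'n^'n \<Rightarrow> real^'n^'m \<Rightarrow> real^'m^'p \<Rightarrow> real^('n + 'm + 'p)^('n + 'm + 'p)" where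
  "P_SS \<alpha> A B C = (1 / 2) *\<^sub>R block_matrix
     (mat \<alpha> + A)   (transpose B)   0
     (- B)          (mat \<alpha>)       (- transpose C)
       0              C              (mat \<alpha>)"

abbreviation complex_matrix :: "real^'n^'m \<Rightarrow> complex^'n^'m" where
  "complex_matrix \<equiv> map_matrix complex_of_real"

(* For A symmetric positive definite and \<alpha> > 0 the symmetric part of P_SS is positive definite, so
   P_SS is invertible and matrix_inv is its genuine inverse. *)
definition SS_preconditioned ::
  "real \<Rightarrow> real^'n^'n \<Rightarrow> real^'n^'m \<Rightarrow> real^'m^'p \<Rightarrow> real^('n + 'm + 'p)^('n + 'm + 'p)" where
  "SS_preconditioned \<alpha> A B C = matrix_inv (P_SS \<alpha> A B C) ** saddle_matrix A B C"

end

theory Submission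
  imports Defs
begin

text \<open>Since \<open>P\<close> is half the sum of \<open>\<alpha> I\<close> and the saddle point matrix \<open>S\<close>, an eigenvector of
  \<open>P\<^sup>-\<^sup>1 S\<close> for \<open>\<lambda>\<close> is one of \<open>S\<close> for \<open>\<theta> = \<alpha> \<lambda> / (2 - \<lambda>)\<close>, so that \<open>\<lambda> = 2 \<theta> / (\<alpha> + \<theta>)\<close>.
  Pairing \<open>S p = \<theta> p\<close> with \<open>p = (u, v, w)\<close> and using that the off-diagonal part of \<open>S\<close> is
  skew-symmetric, the imaginary part gives \<open>|v|\<^sup>2 = |u|\<^sup>2 + |w|\<^sup>2\<close> for non-real \<open>\<theta>\<close>, and the real
  part then gives \<open>u\<^sup>* A u = 2 Re \<theta> |v|\<^sup>2\<close>. Pairing the middle equation with \<open>v\<close> and applying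
  Cauchy-Schwarz gives \<open>|\<theta>|\<^sup>2 \<le> \<tau>\<^sub>m\<^sub>a\<^sub>x + \<beta>\<^sub>m\<^sub>a\<^sub>x\<close>, without \<open>\<beta>\<^sub>m\<^sub>a\<^sub>x\<close> if \<open>C v = 0\<close>. In that case also
  \<open>w = 0\<close>, hence \<open>|u| = |v|\<close>. In general \<open>|u| / |v|\<close> is bounded below through
  \<open>\<tau>\<^sub>m\<^sub>i\<^sub>n |v|\<^sup>2 \<le> |B\<^sup>T v|\<^sup>2 = |\<theta> u - A u|\<^sup>2 \<le> (|\<theta>|\<^sup>2 + \<kappa>\<^sub>m\<^sub>a\<^sub>x\<^sup>2) |u|\<^sup>2\<close>, where the cross term is dropped
  because it equals \<open>- 4 (Re \<theta>)\<^sup>2 |v|\<^sup>2\<close>.\<close>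

section \<open>Rayleigh quotients of real symmetric matrices\<close>

lemma inner_matrix_vector_transpose:
  fixes M :: "real^'n^'m"
  shows "x \<bullet> (M *v y) = (transpose M *v x) \<bullet> y"
  by (metis dot_lmul_matrix transpose_matrix_vector)

text \<open>Along \<open>x + t *\<^sub>R (S *v x)\<close> the form is a quadratic in
  \<open>t\<close> without constant term; unless its linear coefficient vanishes, it is negative for
  small \<open>t < 0\<close>.\<close>

lemma pos_semidef_null_form:
  fixes S :: "real^'n^'n"
  assumes sym: "transpose S = S" and psd: "\<And>x. 0 \<le> x \<bullet> (S *v x)" and null: "x \<bullet> (S *v x) = 0"
  shows "S *v x = 0"
proof -
  define y where "y = S *v x"
  define q where "q = y \<bullet> (S *v y)"
  have form: "(x + t *\<^sub>R y) \<bullet> (S *v (x + t *\<^sub>R y)) = 2 * t * (y \<bullet> y) + t\<^sup>2 * q" for t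
    using null inner_matrix_vector_transpose[of x S y]
    by (simp add: sym q_def y_def[symmetric] matrix_vector_right_distrib matrix_vector_mult_scaleR
        inner_add inner_commute power2_eq_square algebra_simps)
  have q: "0 \<le> q"
    unfolding q_def by (rule psd)
  \<comment> \<open>The minimiser would be \<open>- (y \<bullet> y) / q\<close>; adding 1 keeps the
    denominator positive when \<open>q = 0\<close>.\<close>
  define t where "t = - (y \<bullet> y) / (q + 1)"
  have "0 \<le> 2 * t * (y \<bullet> y) + t\<^sup>2 * q"
    using psd form by metis
  also have "2 * t * (y \<bullet> y) + t\<^sup>2 * q = - ((y \<bullet> y)\<^sup>2 * (q + 2)) / (q + 1)\<^sup>2"
    using q by (simp add: t_def divide_simps) (simp add: power2_eq_square algebra_simps)
  finally have "(y \<bullet> y)\<^sup>2 * (q + 2) \<le> 0"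
    using q by (simp add: divide_simps split: if_splits)
  then have "y \<bullet> y = 0"
    using q by (simp add: mult_le_0_iff)
  then show ?thesis
    by (simp add: y_def)
qed

text \<open>A maximiser of the form on the compact unit sphere is an eigenvector, so no
  diagonalisation is involved.\<close>

lemma symmetric_max_eigenvalue:
  fixes M :: "real^'n^'n"
  assumes sym: "transpose M = M"
  obtains k where "eigenvalue M k" "\<And>x. x \<bullet> (M *v x) \<le> k * (x \<bullet> x)"
proof -
  let ?f = "\<lambda>x. x \<bullet> (M *v x)"
  have "continuous_on (sphere 0 1) ?f"
    by (intro continuous_intros matrix_vector_mult_linear_continuous_on)
  moreover have "sphere (0::real^'n) 1 \<noteq> {}" "compact (sphere (0::real^'n) 1)"
    by simp_all
  ultimately obtain z where z: "norm z = 1" and max: "\<And>y. norm y = 1 \<Longrightarrow> ?f y \<le> ?f z"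
    using continuous_attains_sup[of "sphere 0 1" ?f] by auto
  define k where "k = ?f z"
  have bound: "?f x \<le> k * (x \<bullet> x)" for x
  proof (cases "x = 0")
    case False
    define y where "y = x /\<^sub>R norm x"
    have x: "x = norm x *\<^sub>R y" and "norm y = 1"
      using False by (auto simp: y_def)
    then have "?f y \<le> k"
      using max by (auto simp: k_def)
    moreover have "?f x = (norm x)\<^sup>2 * ?f y"
      by (subst (1 2) x) (simp add: matrix_vector_mult_scaleR power2_eq_square)
    ultimately show ?thesis
      by (metis power2_norm_eq_inner mult.commute mult_left_mono zero_le_power2)
  qed simp
  \<comment> \<open>Maximality of \<open>k\<close> makes \<open>S\<close> positive semidefinite with
    vanishing form at \<open>z\<close>; then \<open>S *v z = 0\<close> is the eigenvalue
    equation.\<close>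
  define S where "S = k *\<^sub>R mat 1 - M"
  have S: "S *v x = k *\<^sub>R x - M *v x" for x
    by (simp add: S_def matrix_vector_mult_diff_rdistrib scaleR_matrix_vector_assoc[symmetric])
  have "transpose S = S"
    using sym by (simp add: S_def transpose_def vec_eq_iff mat_def)
  moreover have "0 \<le> x \<bullet> (S *v x)" for x
    using bound[of x] by (simp add: S inner_diff_right)
  moreover have "z \<bullet> (S *v z) = 0"
    using z by (simp add: S inner_diff_right k_def norm_eq_1)
  ultimately have "S *v z = 0"
    by (rule pos_semidef_null_form)
  then have "eigenvalue M k"
    using z by (auto simp: S eigenvalue_def eigenvector_def scalar_mult_eq_scaleR intro!: exI[of _ z])
  then show thesis
    using bound that by blast
qed

text \<open>Eigenvectors chosen for distinct eigenvalues are orthogonal, hence independent.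
  Finiteness gives \<open>Max\<close> and \<open>Min\<close> in \<open>lambda_max\<close> and
  \<open>lambda_min\<close> their meaning.\<close>

lemma finite_symmetric_eigenvalues:
  fixes M :: "real^'n^'n"
  assumes sym: "transpose M = M"
  shows "finite {k. eigenvalue M k}"
proof -
  define f where "f k = (SOME x. eigenvector M x k)" for k
  have f: "f k \<noteq> 0 \<and> M *v f k = k *\<^sub>R f k" if "eigenvalue M k" for k
    using that someI_ex[of "\<lambda>x. eigenvector M x k"]
    by (simp add: eigenvalue_def f_def eigenvector_def scalar_mult_eq_scaleR)
  have orth: "f k \<bullet> f l = 0" if "eigenvalue M k" "eigenvalue M l" "k \<noteq> l" for k l
    using f[OF that(1)] f[OF that(2)] that(3) inner_matrix_vector_transpose[of "f k" M "f l"]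
    by (simp add: sym)
  let ?V = "f ` {k. eigenvalue M k}"
  have "pairwise orthogonal ?V"
    using orth by (auto simp: pairwise_def orthogonal_def)
  moreover have "0 \<notin> ?V"
    using f by fastforce
  ultimately have "finite ?V"
    using pairwise_orthogonal_independent independent_imp_finite by blast
  moreover have "inj_on f {k. eigenvalue M k}"
    using orth f by (auto simp: inj_on_def) (metis inner_eq_zero_iff)
  ultimately show ?thesis
    using finite_imageD by blast
qed

lemma rayleigh_le_lambda_max:
  fixes M :: "real^'n^'n"
  assumes "transpose M = M"
  shows "x \<bullet> (M *v x) \<le> lambda_max M * (x \<bullet> x)"
proof -
  obtain k where k: "eigenvalue M k" "x \<bullet> (M *v x) \<le> k * (x \<bullet> x)"
    using symmetric_max_eigenvalue[OF assms] by metis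
  have "k \<le> lambda_max M"
    unfolding lambda_max_def using finite_symmetric_eigenvalues[OF assms] k(1) by (intro Max_ge) auto
  then show ?thesis
    using k(2) by (smt (verit) inner_ge_zero mult_right_mono)
qed

lemma lambda_min_le_rayleigh:
  fixes M :: "real^'n^'n"
  assumes "transpose M = M"
  shows "lambda_min M * (x \<bullet> x) \<le> x \<bullet> (M *v x)"
proof -
  have neg: "transpose (- M) = - M"
    using assms by (simp add: transpose_def vec_eq_iff)
  have mult: "(- M) *v y = - (M *v y)" for y
    by (simp add: matrix_vector_mult_def vec_eq_iff sum_negf)
  obtain k where k: "eigenvalue (- M) k" "x \<bullet> ((- M) *v x) \<le> k * (x \<bullet> x)"
    using symmetric_max_eigenvalue[OF neg] by metis
  have "eigenvalue M (- k)"
    using k(1) unfolding eigenvalue_def eigenvector_def mult scalar_mult_eq_scaleR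
    by (metis add.inverse_inverse scaleR_minus_left)
  then have "lambda_min M \<le> - k"
    unfolding lambda_min_def using finite_symmetric_eigenvalues[OF assms] by (intro Min_le) auto
  then have "lambda_min M * (x \<bullet> x) \<le> - k * (x \<bullet> x)"
    by (intro mult_right_mono) auto
  then show ?thesis
    using k(2) by (simp add: mult)
qed

lemma lambda_min_pos:
  assumes "sym_pos_def A"
  shows "0 < lambda_min A"
proof -
  have sym: "transpose A = A"
    using assms by (simp add: sym_pos_def_def)
  then have "{k. eigenvalue A k} \<noteq> {}"
    using symmetric_max_eigenvalue[OF sym] by blast
  then have "eigenvalue A (lambda_min A)"
    unfolding lambda_min_def using Min_in[OF finite_symmetric_eigenvalues[OF sym]] by blast
  then obtain x where x: "x \<noteq> 0" "A *v x = lambda_min A *\<^sub>R x"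
    unfolding eigenvalue_def eigenvector_def scalar_mult_eq_scaleR by blast
  then have "0 < lambda_min A * (x \<bullet> x)"
    using assms unfolding sym_pos_def_def by (metis inner_scaleR_right)
  then show ?thesis
    using x zero_less_mult_pos2 inner_gt_zero_iff by blast
qed

lemma lambda_max_pos:
  assumes "sym_pos_def A"
  shows "0 < lambda_max A"
proof -
  obtain x :: "real^'a" where x: "x \<noteq> 0"
    by (metis axis_eq_0_iff one_neq_zero)
  then have "0 < x \<bullet> (A *v x)"
    using assms by (simp add: sym_pos_def_def)
  also have "\<dots> \<le> lambda_max A * (x \<bullet> x)"
    using assms by (intro rayleigh_le_lambda_max) (simp add: sym_pos_def_def)
  finally show ?thesis
    using x zero_less_mult_pos2 inner_gt_zero_iff by blast
qed

text \<open>Positivity of the form of \<open>A\<close> at (k I - A) x, with k the largest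
  eigenvalue, yields |A x|^2 \<le> k (x \<bullet> A x), without a square root of
  \<open>A\<close>.\<close>

lemma norm_matrix_vector_le_lambda_max:
  assumes "sym_pos_def A"
  shows "(A *v x) \<bullet> (A *v x) \<le> (lambda_max A)\<^sup>2 * (x \<bullet> x)"
proof -
  define k where "k = lambda_max A"
  define y where "y = A *v x"
  define z where "z = k *\<^sub>R x - y"
  have sym: "transpose A = A"
    using assms by (simp add: sym_pos_def_def)
  have k: "0 < k"
    unfolding k_def using assms by (rule lambda_max_pos)
  have "0 \<le> z \<bullet> (A *v z)"
    using assms by (cases "z = 0") (auto simp: sym_pos_def_def less_imp_le)
  also have "\<dots> = k\<^sup>2 * (x \<bullet> y) - 2 * k * (y \<bullet> y) + y \<bullet> (A *v y)"
    using inner_matrix_vector_transpose[of x A y]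
    by (simp add: sym z_def y_def[symmetric] matrix_vector_mult_diff_distrib
        matrix_vector_mult_scaleR inner_diff power2_eq_square algebra_simps inner_commute)
  also have "\<dots> \<le> k\<^sup>2 * (x \<bullet> y) - 2 * k * (y \<bullet> y) + k * (y \<bullet> y)"
    using rayleigh_le_lambda_max[OF sym, of y] by (simp add: k_def)
  finally have "0 \<le> k * (k * (x \<bullet> y) - y \<bullet> y)"
    by (simp add: power2_eq_square algebra_simps)
  then have "y \<bullet> y \<le> k * (x \<bullet> y)"
    using k by (simp add: zero_le_mult_iff)
  also have "\<dots> \<le> k * (k * (x \<bullet> x))"
    using rayleigh_le_lambda_max[OF sym, of x] k by (simp add: y_def k_def)
  finally show ?thesis
    by (simp add: y_def k_def power2_eq_square mult.assoc)
qed

section \<open>Real matrices acting on complex vectors\<close>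

text \<open>The inner product on complex vectors is the library's real one, the real part of the Hermitian
  product. The imaginary part of the Hermitian product is the inner product with \<open>\<i> *s x\<close>.\<close>

definition re_vec :: "complex^'n \<Rightarrow> real^'n" where
  "re_vec x = (\<chi> i. Re (x $ i))"

definition im_vec :: "complex^'n \<Rightarrow> real^'n" where
  "im_vec x = (\<chi> i. Im (x $ i))"

lemma inner_re_im: "x \<bullet> y = re_vec x \<bullet> re_vec y + im_vec x \<bullet> im_vec y"
  by (simp add: inner_vec_def inner_complex_def re_vec_def im_vec_def sum.distrib)

lemma re_vec_complex_matrix: "re_vec (complex_matrix M *v x) = M *v re_vec x"
  by (simp add: re_vec_def matrix_vector_mult_def vec_eq_iff map_matrix_def)

lemma im_vec_complex_matrix: "im_vec (complex_matrix M *v x) = M *v im_vec x"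
  by (simp add: im_vec_def matrix_vector_mult_def vec_eq_iff map_matrix_def)

lemma re_vec_add: "re_vec (x + y) = re_vec x + re_vec y"
  by (simp add: re_vec_def vec_eq_iff)

lemma im_vec_add: "im_vec (x + y) = im_vec x + im_vec y"
  by (simp add: im_vec_def vec_eq_iff)

lemma re_vec_scaleR: "re_vec (c *\<^sub>R x) = c *\<^sub>R re_vec x"
  by (simp add: re_vec_def vec_eq_iff)

lemma im_vec_scaleR: "im_vec (c *\<^sub>R x) = c *\<^sub>R im_vec x"
  by (simp add: im_vec_def vec_eq_iff)

lemmas complex_matrix_re_im = inner_re_im re_vec_complex_matrix im_vec_complex_matrix

lemma inner_complex_matrix_transpose:
  "x \<bullet> (complex_matrix M *v y) = (complex_matrix (transpose M) *v x) \<bullet> y"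
  by (simp add: complex_matrix_re_im inner_matrix_vector_transpose)

text \<open>A real matrix acts separately on real and imaginary parts, so the complex form is a sum
  of two real ones and the real bounds add up.\<close>

lemma complex_rayleigh_le_lambda_max:
  assumes "transpose M = M"
  shows "x \<bullet> (complex_matrix M *v x) \<le> lambda_max M * (x \<bullet> x)"
  using rayleigh_le_lambda_max[OF assms, of "re_vec x"] rayleigh_le_lambda_max[OF assms, of "im_vec x"]
  by (simp add: complex_matrix_re_im algebra_simps)

lemma lambda_min_le_complex_rayleigh:
  assumes "transpose M = M"
  shows "lambda_min M * (x \<bullet> x) \<le> x \<bullet> (complex_matrix M *v x)"
  using lambda_min_le_rayleigh[OF assms, of "re_vec x"] lambda_min_le_rayleigh[OF assms, of "im_vec x"]
  by (simp add: complex_matrix_re_im algebra_simps)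

lemma norm_complex_matrix_vector_le_lambda_max:
  assumes "sym_pos_def A"
  shows "(complex_matrix A *v x) \<bullet> (complex_matrix A *v x) \<le> (lambda_max A)\<^sup>2 * (x \<bullet> x)"
  using norm_matrix_vector_le_lambda_max[OF assms, of "re_vec x"]
    norm_matrix_vector_le_lambda_max[OF assms, of "im_vec x"]
  by (simp add: complex_matrix_re_im algebra_simps)

lemma complex_matrix_mult: "complex_matrix (M ** N) = complex_matrix M ** complex_matrix N"
  by (simp add: matrix_matrix_mult_def map_matrix_def vec_eq_iff)

lemma symmetric_gram: "transpose (transpose M ** M) = transpose M ** (M :: real^'n^'m)"
  by (simp add: matrix_transpose_mul)

lemma inner_complex_gram:
  "x \<bullet> (complex_matrix (transpose M ** M) *v x) = (complex_matrix M *v x) \<bullet> (complex_matrix M *v x)"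
  by (simp add: complex_matrix_mult matrix_vector_mul_assoc[symmetric] inner_complex_matrix_transpose)

text \<open>Taking \<open>M\<close> to be \<open>transpose B\<close> or \<open>C\<close> produces
  the eigenvalues of \<open>B ** transpose B\<close> or \<open>transpose C ** C\<close>.\<close>

lemma norm_le_lambda_max_gram:
  "(complex_matrix M *v x) \<bullet> (complex_matrix M *v x) \<le> lambda_max (transpose M ** M) * (x \<bullet> x)"
  using complex_rayleigh_le_lambda_max[OF symmetric_gram, of x M] by (simp add: inner_complex_gram)

lemma lambda_min_gram_le_norm:
  "lambda_min (transpose M ** M) * (x \<bullet> x) \<le> (complex_matrix M *v x) \<bullet> (complex_matrix M *v x)"
  using lambda_min_le_complex_rayleigh[OF symmetric_gram, of M x] by (simp add: inner_complex_gram)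

section \<open>Multiplication by the imaginary unit and imaginary parts of Hermitian
  products\<close>

lemma inner_imaginary_unit: "(\<i> *s x) \<bullet> y = - (x \<bullet> (\<i> *s y))"
  by (simp add: inner_vec_def inner_complex_def sum_negf[symmetric] algebra_simps)

lemma inner_imaginary_unit_self: "(\<i> *s x) \<bullet> x = 0"
  using inner_imaginary_unit[of x x] by (simp add: inner_commute)

text \<open>The inner product is only real-bilinear, so complex factors are split before they are
  pulled out.\<close>

lemma complex_scalar_split: "c *s x = Re c *\<^sub>R x + Im c *\<^sub>R (\<i> *s x)"
  by (simp add: vec_eq_iff complex_eq_iff)

lemma inner_complex_scalar_self: "x \<bullet> (c *s x) = Re c * (x \<bullet> x)"
  using inner_imaginary_unit_self[of x]
  by (simp add: complex_scalar_split[of c] inner_add_right inner_commute)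

lemma inner_imaginary_unit_isometry: "(\<i> *s x) \<bullet> (\<i> *s y) = x \<bullet> y"
  by (simp add: inner_vec_def inner_complex_def add.commute)

lemma inner_imaginary_complex_scalar_self: "(\<i> *s x) \<bullet> (c *s x) = Im c * (x \<bullet> x)"
  by (simp add: complex_scalar_split[of c] inner_add_right inner_imaginary_unit_self
      inner_imaginary_unit_isometry)

lemma norm_complex_scalar: "(c *s x) \<bullet> (c *s x) = (cmod c)\<^sup>2 * (x \<bullet> x)"
  using inner_imaginary_unit_self[of x] unfolding cmod_power2
  by (simp add: complex_scalar_split[of c] inner_add inner_imaginary_unit_isometry inner_commute
      power2_eq_square algebra_simps)

lemma complex_matrix_imaginary_unit:
  "complex_matrix M *v (\<i> *s x) = \<i> *s (complex_matrix M *v x)"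
  by (simp add: vector_scalar_commute)

text \<open>Moving \<open>M\<close> across transposes it, and moving the skew-adjoint factor \<i>
  across flips the sign.\<close>

lemma inner_imaginary_unit_complex_matrix:
  "(\<i> *s x) \<bullet> (complex_matrix M *v y) = - ((\<i> *s y) \<bullet> (complex_matrix (transpose M) *v x))"
proof -
  have "(\<i> *s x) \<bullet> (complex_matrix M *v y) = (\<i> *s (complex_matrix (transpose M) *v x)) \<bullet> y"
    by (simp add: inner_complex_matrix_transpose complex_matrix_imaginary_unit)
  then show ?thesis
    by (simp only: inner_imaginary_unit[of "_ *v x"]) (simp only: inner_commute)
qed

lemma symmetric_inner_imaginary_unit:
  assumes "transpose M = M"
  shows "(\<i> *s x) \<bullet> (complex_matrix M *v x) = 0"
  using inner_imaginary_unit_complex_matrix[of x M x] by (simp add: assms)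

section \<open>Block vectors and the preconditioner\<close>

lemma sum_UNIV_sum_type:
  fixes f :: "'a::finite + 'b::finite \<Rightarrow> 'c::comm_monoid_add"
  shows "(\<Sum>i\<in>UNIV. f i) = (\<Sum>a\<in>UNIV. f (Inl a)) + (\<Sum>b\<in>UNIV. f (Inr b))"
  using sum.Plus[of UNIV UNIV f] by (simp add: UNIV_Plus_UNIV o_def)

lemma block_vector_eq_iff:
  "block_vector u v w = block_vector u' v' w' \<longleftrightarrow> u = u' \<and> v = v' \<and> w = w'"
  by (auto simp: block_vector_def vec_eq_iff split: sum.splits)

lemma block_vector_zero: "block_vector 0 0 0 = 0"
  by (simp add: block_vector_def vec_eq_iff split: sum.splits)

lemma block_vector_exhaust:
  obtains u v w where "x = block_vector u v w"
proof
  show "x = block_vector (\<chi> i. x $ Inl i) (\<chi> i. x $ Inr (Inl i)) (\<chi> i. x $ Inr (Inr i))"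
    by (simp add: block_vector_def vec_eq_iff split: sum.splits)
qed

lemma block_vector_scalar: "c *s block_vector u v w = block_vector (c *s u) (c *s v) (c *s w)"
  by (simp add: block_vector_def vec_eq_iff split: sum.splits)

lemma inner_block_vector:
  "block_vector u v w \<bullet> block_vector u' v' w' = u \<bullet> u' + v \<bullet> v' + w \<bullet> w'"
  by (simp add: inner_vec_def block_vector_def sum_UNIV_sum_type add.assoc)

lemma block_matrix_mult_block_vector:
  fixes u :: "'a::semiring_1^'n::finite" and v :: "'a^'m::finite" and w :: "'a^'p::finite"
  shows "block_matrix M11 M12 M13 M21 M22 M23 M31 M32 M33 *v block_vector u v w =
    block_vector (M11 *v u + M12 *v v + M13 *v w) (M21 *v u + M22 *v v + M23 *v w)
      (M31 *v u + M32 *v v + M33 *v w)"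
  by (simp add: block_matrix_def block_vector_def matrix_vector_mult_def vec_eq_iff
      sum_UNIV_sum_type add.assoc split: sum.splits)

lemma complex_block_matrix:
  "complex_matrix (block_matrix M11 M12 M13 M21 M22 M23 M31 M32 M33) =
    block_matrix (complex_matrix M11) (complex_matrix M12) (complex_matrix M13)
      (complex_matrix M21) (complex_matrix M22) (complex_matrix M23)
      (complex_matrix M31) (complex_matrix M32) (complex_matrix M33)"
  by (simp add: block_matrix_def block_vector_def map_matrix_def vec_eq_iff split: sum.splits)

lemma complex_matrix_uminus: "complex_matrix (- M) = - complex_matrix M"
  by (simp add: map_matrix_def vec_eq_iff)

lemma complex_matrix_zero: "complex_matrix 0 = 0"
  by (simp add: map_matrix_def vec_eq_iff)

lemma uminus_matrix_vector_mult: "(- M) *v x = - (M *v x)" for M :: "'a::ring_1^'n^'m"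
  by (simp add: matrix_vector_mult_def vec_eq_iff sum_negf)

lemma saddle_matrix_mult_block_vector:
  "saddle_matrix A B C *v block_vector u v w =
    block_vector (A *v u + transpose B *v v) (- (B *v u) - transpose C *v w) (C *v v)"
  by (simp add: saddle_matrix_def block_matrix_mult_block_vector uminus_matrix_vector_mult)

lemma complex_saddle_matrix_mult_block_vector:
  "complex_matrix (saddle_matrix A B C) *v block_vector u v w =
    block_vector (complex_matrix A *v u + complex_matrix (transpose B) *v v)
      (- (complex_matrix B *v u) - complex_matrix (transpose C) *v w) (complex_matrix C *v v)"
  by (simp add: saddle_matrix_def complex_block_matrix block_matrix_mult_block_vector
      complex_matrix_uminus complex_matrix_zero uminus_matrix_vector_mult)

section \<open>The preconditioner as a shifted saddle point matrix, its invertibility and the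
  transfer of eigenvectors\<close>

lemma P_SS_shift: "P_SS \<alpha> A B C = (1 / 2) *\<^sub>R (\<alpha> *\<^sub>R mat 1 + saddle_matrix A B C)"
  by (auto simp: P_SS_def saddle_matrix_def block_matrix_def block_vector_def vec_eq_iff mat_def
      split: sum.splits)

lemma P_SS_mult: "P_SS \<alpha> A B C *v x = (1 / 2) *\<^sub>R (\<alpha> *\<^sub>R x + saddle_matrix A B C *v x)"
  by (simp add: P_SS_shift scaleR_matrix_vector_assoc[symmetric] matrix_vector_mult_add_rdistrib)

lemma complex_P_SS_mult:
  "complex_matrix (P_SS \<alpha> A B C) *v x =
    (1 / 2) *\<^sub>R (\<alpha> *\<^sub>R x + complex_matrix (saddle_matrix A B C) *v x)"
  (is "?l = ?r")
proof -
  have "re_vec ?l = re_vec ?r" "im_vec ?l = im_vec ?r"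
    unfolding re_vec_complex_matrix im_vec_complex_matrix P_SS_mult re_vec_scaleR im_vec_scaleR
      re_vec_add im_vec_add by (rule refl)+
  then show ?thesis
    by (simp add: re_vec_def im_vec_def vec_eq_iff complex_eq_iff)
qed

text \<open>The terms with \<open>B\<close> and with \<open>C\<close> each occur twice with opposite
  signs and cancel.\<close>

lemma inner_saddle_matrix:
  fixes A :: "real^'n^'n" and B :: "real^'n^'m" and C :: "real^'m^'p"
  shows "block_vector u v w \<bullet> (saddle_matrix A B C *v block_vector u v w) = u \<bullet> (A *v u)"
  using inner_matrix_vector_transpose[of v B u] inner_matrix_vector_transpose[of w C v]
  by (simp add: saddle_matrix_mult_block_vector inner_block_vector inner_add_right inner_diff_right
      inner_commute)

lemma matrix_inv_right: "invertible M \<Longrightarrow> M ** matrix_inv M = mat 1"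
  unfolding invertible_def matrix_inv_def by (metis (mono_tags, lifting) someI_ex)

text \<open>Pairing a kernel vector \<open>x\<close> with its image leaves \<alpha> |x|^2 plus a
  nonnegative term, so the kernel is trivial.\<close>

lemma invertible_P_SS:
  fixes A :: "real^'n^'n" and B :: "real^'n^'m" and C :: "real^'m^'p"
  assumes A: "sym_pos_def A" and \<alpha>: "\<alpha> > 0"
  shows "invertible (P_SS \<alpha> A B C)"
proof -
  have "x = 0" if "P_SS \<alpha> A B C *v x = 0" for x
  proof -
    obtain u v w where x: "x = block_vector u v w"
      by (rule block_vector_exhaust)
    have "0 \<le> u \<bullet> (A *v u)"
      using A by (cases "u = 0") (auto simp: sym_pos_def_def less_imp_le)
    moreover have "0 = x \<bullet> (\<alpha> *\<^sub>R x + saddle_matrix A B C *v x)"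
      using that by (simp add: P_SS_mult)
    moreover have "x \<bullet> (\<alpha> *\<^sub>R x + saddle_matrix A B C *v x) = \<alpha> * (x \<bullet> x) + u \<bullet> (A *v u)"
      by (simp add: x inner_saddle_matrix inner_add_right)
    ultimately have "\<alpha> * (x \<bullet> x) \<le> 0"
      by linarith
    then show ?thesis
      using \<alpha> by (metis inner_gt_zero_iff mult_pos_pos not_less)
  qed
  then show ?thesis
    using matrix_left_invertible_ker invertible_left_inverse by blast
qed

lemma eigenvector_SS_preconditioned:
  fixes A :: "real^'n^'n" and B :: "real^'n^'m" and C :: "real^'m^'p"
  assumes A: "sym_pos_def A" and \<alpha>: "\<alpha> > 0" and "lam \<noteq> 2"
    and eigen: "eigenvector (complex_matrix (SS_preconditioned \<alpha> A B C)) x lam"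
  shows "eigenvector (complex_matrix (saddle_matrix A B C)) x (of_real \<alpha> * (lam / (2 - lam)))"
proof -
  let ?S = "complex_matrix (saddle_matrix A B C)"
  let ?P = "complex_matrix (P_SS \<alpha> A B C)"
  have "P_SS \<alpha> A B C ** SS_preconditioned \<alpha> A B C = saddle_matrix A B C"
    by (simp add: SS_preconditioned_def matrix_mul_assoc matrix_inv_right[OF invertible_P_SS[OF A \<alpha>]])
  then have "?S *v x = ?P *v (complex_matrix (SS_preconditioned \<alpha> A B C) *v x)"
    by (simp add: matrix_vector_mul_assoc complex_matrix_mult[symmetric])
  also have "\<dots> = lam *s (?P *v x)"
    using eigen by (simp add: eigenvector_def vector_scalar_commute)
  finally have eq: "?S *v x = lam *s ((1 / 2) *\<^sub>R (\<alpha> *\<^sub>R x + ?S *v x))"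
    by (simp add: complex_P_SS_mult)
  \<comment> \<open>Componentwise, \<open>eq\<close> is a linear equation for one complex number,
    solvable as \<open>lam\<close> differs from 2.\<close>
  have "(?S *v x) $ i = (of_real \<alpha> * (lam / (2 - lam))) * x $ i" for i
  proof -
    have "(?S *v x) $ i = lam * ((1 / 2) *\<^sub>R (\<alpha> *\<^sub>R x $ i + (?S *v x) $ i))"
      by (subst eq) simp
    then show ?thesis
      using \<open>lam \<noteq> 2\<close> by (simp add: scaleR_conv_of_real field_simps)
  qed
  then have "?S *v x = (of_real \<alpha> * (lam / (2 - lam))) *s x"
    by (simp add: vec_eq_iff)
  then show ?thesis
    using eigen by (simp add: eigenvector_def)
qed

section \<open>Non-real eigenvalues of the saddle point matrix\<close>

text \<open>Cauchy-Schwarz for (p, q) and (u, w) gives r^2 \<le> s r (|u|^2 + |w|^2), and one factor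
  \<open>r\<close> cancels.\<close>

lemma cauchy_schwarz_pair:
  fixes p u :: "'a::real_inner" and q w :: "'b::real_inner"
  assumes "p \<bullet> p + q \<bullet> q \<le> s * r" and r: "r = - (p \<bullet> u + q \<bullet> w)" and "0 < r"
  shows "r \<le> s * (u \<bullet> u + w \<bullet> w)"
proof -
  have "p \<noteq> 0 \<or> q \<noteq> 0"
    using assms by auto
  then have "0 < p \<bullet> p + q \<bullet> q"
    by (auto intro: add_pos_nonneg add_nonneg_pos)
  then have s: "0 < s"
    using assms by (smt (verit) mult_nonneg_nonpos2 mult_nonpos_nonneg)
  \<comment> \<open>The weight \<open>s\<close> lets \<open>s * r\<close> absorb |p|^2 + |q|^2 and
    leaves a common factor \<open>s\<close>.\<close>
  have "0 \<le> (p + s *\<^sub>R u) \<bullet> (p + s *\<^sub>R u) + (q + s *\<^sub>R w) \<bullet> (q + s *\<^sub>R w)"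
    by simp
  also have "\<dots> = (p \<bullet> p + q \<bullet> q) - 2 * s * r + s * (s * (u \<bullet> u + w \<bullet> w))"
    by (simp add: r inner_add inner_commute algebra_simps)
  also have "\<dots> \<le> s * (s * (u \<bullet> u + w \<bullet> w) - r)"
    using assms(1) by (simp add: algebra_simps)
  finally show ?thesis
    using s by (simp add: zero_le_mult_iff)
qed

text \<open>The preconditioner and \<alpha> are gone here: only a non-real eigenvalue \<theta> of
  the saddle point matrix is studied.\<close>

locale saddle_eigen =
  fixes A :: "real^'n^'n" and B :: "real^'n^'m" and C :: "real^'m^'p" and \<theta> :: complex
    and u :: "complex^'n" and v :: "complex^'m" and w :: "complex^'p"
  assumes A: "sym_pos_def A"
    and eigen: "eigenvector (complex_matrix (saddle_matrix A B C)) (block_vector u v w) \<theta>"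
    and nonreal: "Im \<theta> \<noteq> 0"
begin

lemma block_equations:
  "complex_matrix A *v u + complex_matrix (transpose B) *v v = \<theta> *s u"
  "- (complex_matrix B *v u) - complex_matrix (transpose C) *v w = \<theta> *s v"
  "complex_matrix C *v v = \<theta> *s w"
  using eigen unfolding eigenvector_def complex_saddle_matrix_mult_block_vector block_vector_scalar
    block_vector_eq_iff by blast+

lemma A_symmetric: "transpose A = A"
  using A by (simp add: sym_pos_def_def)

lemma energy_real:
  "u \<bullet> (complex_matrix A *v u) = Re \<theta> * (u \<bullet> u + v \<bullet> v + w \<bullet> w)"
proof -
  have "u \<bullet> (\<theta> *s u) + v \<bullet> (\<theta> *s v) + w \<bullet> (\<theta> *s w) = u \<bullet> (complex_matrix A *v u)"
    unfolding block_equations[symmetric]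
    using inner_complex_matrix_transpose[of v B u] inner_complex_matrix_transpose[of w C v]
    by (simp add: inner_add_right inner_diff_right inner_commute)
  then show ?thesis
    by (simp add: inner_complex_scalar_self algebra_simps)
qed

text \<open>The off-diagonal blocks are skew-adjoint, so their contributions to the imaginary parts of the
  three block equations balance out with the sign of \<open>v\<close> reversed.\<close>

lemma energy_imaginary: "v \<bullet> v = u \<bullet> u + w \<bullet> w"
proof -
  have "(\<i> *s u) \<bullet> (\<theta> *s u) + (\<i> *s w) \<bullet> (\<theta> *s w) = (\<i> *s v) \<bullet> (\<theta> *s v)"
    unfolding block_equations[symmetric]
    using inner_imaginary_unit_complex_matrix[of v B u] inner_imaginary_unit_complex_matrix[of w C v]
    by (simp add: inner_add_right inner_diff_right symmetric_inner_imaginary_unit[OF A_symmetric])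
  then have "Im \<theta> * (u \<bullet> u + w \<bullet> w) = Im \<theta> * (v \<bullet> v)"
    by (simp add: inner_imaginary_complex_scalar_self algebra_simps)
  then show ?thesis
    using nonreal by simp
qed

text \<open>If \<open>v\<close> vanished, the energy balance would force \<open>u\<close> and
  \<open>w\<close> to vanish too. This permits cancelling |v|^2 later.\<close>

lemma v_pos: "0 < v \<bullet> v"
proof -
  have "u \<noteq> 0 \<or> v \<noteq> 0 \<or> w \<noteq> 0"
    using eigen by (auto simp: eigenvector_def block_vector_zero)
  then show ?thesis
    using energy_imaginary by (smt (verit) inner_ge_zero inner_eq_zero_iff)
qed

lemma rayleigh_eq: "u \<bullet> (complex_matrix A *v u) = 2 * Re \<theta> * (v \<bullet> v)"
  using energy_real energy_imaginary by (simp add: algebra_simps)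

lemma Re_lower: "lambda_min A * (u \<bullet> u) \<le> 2 * Re \<theta> * (v \<bullet> v)"
  using lambda_min_le_complex_rayleigh[OF A_symmetric, of u] by (simp add: rayleigh_eq)

lemma Re_upper: "Re \<theta> \<le> lambda_max A / 2"
proof -
  have "2 * Re \<theta> * (v \<bullet> v) \<le> lambda_max A * (u \<bullet> u)"
    using complex_rayleigh_le_lambda_max[OF A_symmetric, of u] by (simp add: rayleigh_eq)
  also have "\<dots> \<le> lambda_max A * (v \<bullet> v)"
    using lambda_max_pos[OF A] by (simp add: energy_imaginary)
  finally show ?thesis
    using v_pos by simp
qed

text \<open>Keeping \<beta> a parameter covers both cases of the theorem: 0 if \<open>C\<close>
  annihilates \<open>v\<close>, the largest eigenvalue of \<open>transpose C ** C\<close>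
  otherwise.\<close>

lemma cmod_bound:
  assumes C: "(complex_matrix C *v v) \<bullet> (complex_matrix C *v v) \<le> \<beta> * (v \<bullet> v)"
  shows "(cmod \<theta>)\<^sup>2 \<le> lambda_max (B ** transpose B) + \<beta>"
proof -
  let ?s = "lambda_max (B ** transpose B) + \<beta>"
  \<comment> \<open>Testing the middle equation with \<theta> v instead of \<open>v\<close> makes
    its right-hand side the positive real number |z|^2.\<close>
  define z where "z = \<theta> *s v"
  define p where "p = complex_matrix (transpose B) *v z"
  define q where "q = complex_matrix C *v z"
  have zz: "z \<bullet> z = (cmod \<theta>)\<^sup>2 * (v \<bullet> v)"
    by (simp add: z_def norm_complex_scalar)
  have "p \<bullet> p \<le> lambda_max (B ** transpose B) * (z \<bullet> z)"
    using norm_le_lambda_max_gram[of "transpose B" z] by (simp add: p_def)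
  moreover have "q \<bullet> q \<le> \<beta> * (z \<bullet> z)"
    using mult_left_mono[OF C, of "(cmod \<theta>)\<^sup>2"]
    by (simp add: q_def z_def vector_scalar_commute norm_complex_scalar mult.left_commute)
  ultimately have "p \<bullet> p + q \<bullet> q \<le> ?s * (z \<bullet> z)"
    by (simp add: distrib_right)
  moreover have "z \<bullet> z = - (p \<bullet> u + q \<bullet> w)"
  proof -
    have "z \<bullet> z = z \<bullet> (- (complex_matrix B *v u) - complex_matrix (transpose C) *v w)"
      by (simp add: block_equations z_def)
    then show ?thesis
      by (simp add: inner_diff_right inner_complex_matrix_transpose p_def q_def)
  qed
  moreover have "0 < z \<bullet> z"
    unfolding zz using v_pos nonreal by (intro mult_pos_pos) auto
  ultimately have "z \<bullet> z \<le> ?s * (u \<bullet> u + w \<bullet> w)"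
    by (rule cauchy_schwarz_pair)
  then show ?thesis
    using v_pos by (simp add: zz energy_imaginary[symmetric])
qed

lemma u_lower:
  assumes "(cmod \<theta>)\<^sup>2 \<le> s"
  shows "lambda_min (B ** transpose B) * (v \<bullet> v) \<le> ((lambda_max A)\<^sup>2 + s) * (u \<bullet> u)"
proof -
  let ?Au = "complex_matrix A *v u"
  have Bv: "complex_matrix (transpose B) *v v = \<theta> *s u - ?Au"
    using block_equations(1) by (simp add: eq_diff_eq add.commute)
  \<comment> \<open>As u* A u is real, only Re \<theta> contributes; \<open>rayleigh_eq\<close>
    supplies a second factor Re \<theta>, so the cross term is nonnegative.\<close>
  have cross: "(\<theta> *s u) \<bullet> ?Au = 2 * (Re \<theta>)\<^sup>2 * (v \<bullet> v)"
    by (simp add: complex_scalar_split[of \<theta>] inner_add_left rayleigh_eq power2_eq_square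
        symmetric_inner_imaginary_unit[OF A_symmetric])
  have "lambda_min (B ** transpose B) * (v \<bullet> v) \<le> (\<theta> *s u - ?Au) \<bullet> (\<theta> *s u - ?Au)"
    using lambda_min_gram_le_norm[of "transpose B" v] by (simp add: Bv)
  also have "\<dots> = (cmod \<theta>)\<^sup>2 * (u \<bullet> u) - 2 * ((\<theta> *s u) \<bullet> ?Au) + ?Au \<bullet> ?Au"
    by (simp add: inner_diff norm_complex_scalar inner_commute)
  also have "\<dots> \<le> s * (u \<bullet> u) + (lambda_max A)\<^sup>2 * (u \<bullet> u)"
  proof -
    have "(cmod \<theta>)\<^sup>2 * (u \<bullet> u) \<le> s * (u \<bullet> u)"
      using assms by (intro mult_right_mono) auto
    moreover have "0 \<le> (\<theta> *s u) \<bullet> ?Au"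
      unfolding cross by simp
    ultimately show ?thesis
      using norm_complex_matrix_vector_le_lambda_max[OF A, of u] by linarith
  qed
  finally show ?thesis
    by (simp add: algebra_simps)
qed

lemma w_zero:
  assumes "complex_matrix C *v v = 0"
  shows "w = 0"
  using assms block_equations(3) nonreal by (auto simp: vec_eq_iff)

end

section \<open>The bounds for the preconditioned matrix\<close>

text \<open>By the triangle inequality the modulus is at least 2 t / (\<alpha> + t) with t =
  |\<theta>|. This increases in t and equals the bound at t = k / 2.\<close>

lemma cmod_preconditioned_lower:
  fixes \<theta> :: complex
  assumes \<alpha>: "0 < \<alpha>" and k: "0 < k" and Re: "k / 2 \<le> Re \<theta>"
  shows "2 * k / (2 * \<alpha> + k) \<le> cmod (2 * \<theta> / (of_real \<alpha> + \<theta>))"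
proof -
  have t: "k / 2 \<le> cmod \<theta>"
    using Re complex_Re_le_cmod[of \<theta>] by linarith
  have "of_real \<alpha> + \<theta> \<noteq> 0"
    using \<alpha> k Re by (auto simp: complex_eq_iff)
  moreover have "cmod (of_real \<alpha> + \<theta>) \<le> \<alpha> + cmod \<theta>"
    using norm_triangle_ineq[of "of_real \<alpha>" \<theta>] \<alpha> by simp
  ultimately have "2 * cmod \<theta> / (\<alpha> + cmod \<theta>) \<le> cmod (2 * \<theta> / (of_real \<alpha> + \<theta>))"
    by (simp add: norm_mult norm_divide frac_le)
  moreover have "2 * k / (2 * \<alpha> + k) \<le> 2 * cmod \<theta> / (\<alpha> + cmod \<theta>)"
  proof -
    have "\<alpha> * k \<le> \<alpha> * (2 * cmod \<theta>)"
      using t \<alpha> by (intro mult_left_mono) auto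
    then have "2 * k * (\<alpha> + cmod \<theta>) \<le> 2 * cmod \<theta> * (2 * \<alpha> + k)"
      by (simp add: algebra_simps)
    moreover have "0 < \<alpha> + cmod \<theta>" "0 < 2 * \<alpha> + k"
      using \<alpha> k by (simp_all add: add_pos_nonneg)
    ultimately show ?thesis
      by (simp add: pos_divide_le_eq pos_le_divide_eq)
  qed
  ultimately show ?thesis
    by linarith
qed

text \<open>Expanding |\<alpha> + \<theta>|^2 keeps the term 2 \<alpha> Re \<theta> \<ge> \<alpha>
  k; the resulting quotient increases with |\<theta>|^2.\<close>

lemma cmod_preconditioned_upper:
  fixes \<theta> :: complex
  assumes \<alpha>: "0 < \<alpha>" and k: "0 < k" and Re: "k / 2 \<le> Re \<theta>" and t: "(cmod \<theta>)\<^sup>2 \<le> t"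
  shows "cmod (2 * \<theta> / (of_real \<alpha> + \<theta>)) \<le> sqrt (4 * t / (\<alpha>\<^sup>2 + \<alpha> * k + t))"
proof (rule real_le_rsqrt)
  define r where "r = (cmod \<theta>)\<^sup>2"
  have r: "0 \<le> r" "r \<le> t"
    using t by (auto simp: r_def)
  have ak: "0 < \<alpha> * k"
    using \<alpha> k by simp
  have "(cmod (of_real \<alpha> + \<theta>))\<^sup>2 = \<alpha>\<^sup>2 + 2 * \<alpha> * Re \<theta> + r"
    unfolding r_def cmod_power2 by (simp add: power2_eq_square algebra_simps)
  moreover have "\<alpha> * k \<le> 2 * \<alpha> * Re \<theta>"
    using Re \<alpha> by simp
  ultimately have "\<alpha>\<^sup>2 + \<alpha> * k + r \<le> (cmod (of_real \<alpha> + \<theta>))\<^sup>2"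
    by simp
  moreover have "(cmod (2 * \<theta> / (of_real \<alpha> + \<theta>)))\<^sup>2 = 4 * r / (cmod (of_real \<alpha> + \<theta>))\<^sup>2"
    by (simp add: r_def norm_divide norm_mult power_divide power_mult_distrib)
  moreover have "0 < \<alpha>\<^sup>2 + \<alpha> * k + r"
    using ak r by (simp add: add_nonneg_pos add_pos_nonneg)
  ultimately have "(cmod (2 * \<theta> / (of_real \<alpha> + \<theta>)))\<^sup>2 \<le> 4 * r / (\<alpha>\<^sup>2 + \<alpha> * k + r)"
    using r by (simp add: frac_le)
  also have "\<dots> \<le> 4 * t / (\<alpha>\<^sup>2 + \<alpha> * k + t)"
  proof -
    define c where "c = \<alpha>\<^sup>2 + \<alpha> * k"
    have "0 < c"
      using ak by (simp add: c_def add_nonneg_pos)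
    then have "r * (c + t) \<le> t * (c + r)"
      using r by (simp add: algebra_simps mult_right_mono)
    then show ?thesis
      using \<open>0 < c\<close> r unfolding c_def[symmetric] by (simp add: divide_simps mult.commute)
  qed
  finally show "(cmod (2 * \<theta> / (of_real \<alpha> + \<theta>)))\<^sup>2 \<le> 4 * t / (\<alpha>\<^sup>2 + \<alpha> * k + t)" .
qed

theorem corollary4p3:
  fixes A :: "real^'n^'n" and B :: "real^'n^'m" and C :: "real^'m^'p"
    and \<alpha> \<kappa>_min \<kappa>_max \<tau>_min \<tau>_max \<beta>_max :: real
    and lam :: complex
    and u :: "complex^'n" and v :: "complex^'m" and w :: "complex^'p"
  assumes A: "sym_pos_def A"
    and B: "rank B = CARD('m)"
    and C: "rank C = CARD('p)"
    and \<alpha>: "\<alpha> > 0"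
    and eigen: "eigenvector (complex_matrix (SS_preconditioned \<alpha> A B C)) (block_vector u v w) lam"
    and nonreal: "Im lam \<noteq> 0"
    and \<kappa>_min: "\<kappa>_min = lambda_min A"
    and \<kappa>_max: "\<kappa>_max = lambda_max A"
    and \<tau>_min: "\<tau>_min = lambda_min (B ** transpose B)"
    and \<tau>_max: "\<tau>_max = lambda_max (B ** transpose B)"
    and \<beta>_max: "\<beta>_max = lambda_max (transpose C ** C)"
  shows "(complex_matrix C *v v = 0 \<longrightarrow>
            2 * \<kappa>_min / (2 * \<alpha> + \<kappa>_min) \<le> cmod lam \<and>
            cmod lam \<le> sqrt (4 * \<tau>_max / (\<alpha>\<^sup>2 + \<alpha> * \<kappa>_min + \<tau>_max))) \<and>
         (complex_matrix C *v v \<noteq> 0 \<longrightarrow>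
            \<kappa>_min * \<tau>_min / (2 * \<alpha> * (\<kappa>_max\<^sup>2 + \<tau>_max + \<beta>_max)) \<le> Re (lam / (2 - lam)) \<and>
            Re (lam / (2 - lam)) \<le> \<kappa>_max / (2 * \<alpha>) \<and>
            \<bar>Im (lam / (2 - lam))\<bar> \<le> sqrt (\<tau>_max + \<beta>_max) / \<alpha>)"
proof -
  define \<mu> where "\<mu> = lam / (2 - lam)"
  define \<theta> where "\<theta> = of_real \<alpha> * \<mu>"
  have lam2: "2 - lam \<noteq> 0"
    using nonreal by auto
  have Re_\<mu>: "Re \<mu> = Re \<theta> / \<alpha>" and Im_\<mu>: "Im \<mu> = Im \<theta> / \<alpha>"
    using \<alpha> by (simp_all add: \<theta>_def)
  have "\<theta> * (2 - lam) = of_real \<alpha> * lam"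
    using lam2 by (simp add: \<theta>_def \<mu>_def)
  then have eq: "lam * (of_real \<alpha> + \<theta>) = 2 * \<theta>"
    by (simp add: algebra_simps)
  \<comment> \<open>Otherwise \<open>eq\<close> would give \<theta> = 0 and hence \<alpha> =
    0.\<close>
  have "of_real \<alpha> + \<theta> \<noteq> 0"
  proof
    assume "of_real \<alpha> + \<theta> = 0"
    then show False
      using eq \<alpha> by auto
  qed
  then have lam: "lam = 2 * \<theta> / (of_real \<alpha> + \<theta>)"
    using eq by (simp add: field_simps)
  have "Im \<theta> \<noteq> 0"
  proof
    assume "Im \<theta> = 0"
    then have "\<theta> = of_real (Re \<theta>)"
      by (simp add: complex_eq_iff)
    then have "lam = of_real (2 * Re \<theta> / (\<alpha> + Re \<theta>))"
      using lam by (metis of_real_add of_real_divide of_real_mult of_real_numeral)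
    then show False
      using nonreal by (metis Im_complex_of_real)
  qed
  then interpret saddle_eigen A B C \<theta> u v w
    using A eigenvector_SS_preconditioned[OF A \<alpha> _ eigen] lam2
    by unfold_locales (auto simp: \<theta>_def \<mu>_def)
  have k: "0 < \<kappa>_min" "0 < \<kappa>_max"
    using lambda_min_pos[OF A] lambda_max_pos[OF A] by (simp_all add: \<kappa>_min \<kappa>_max)
  show ?thesis
    unfolding \<mu>_def[symmetric]
  proof (intro conjI impI)
    assume Cv: "complex_matrix C *v v = 0"
    \<comment> \<open>With \<open>w = 0\<close> the energy balance lets |v|^2 cancel in
      \<open>Re_lower\<close>.\<close>
    have "v \<bullet> v = u \<bullet> u"
      using energy_imaginary w_zero[OF Cv] by simp
    then have Re: "\<kappa>_min / 2 \<le> Re \<theta>"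
      using Re_lower v_pos by (simp add: \<kappa>_min)
    show "2 * \<kappa>_min / (2 * \<alpha> + \<kappa>_min) \<le> cmod lam"
      unfolding lam using \<alpha> k(1) Re by (rule cmod_preconditioned_lower)
    have "(cmod \<theta>)\<^sup>2 \<le> \<tau>_max"
      using cmod_bound[of 0] Cv by (simp add: \<tau>_max)
    then show "cmod lam \<le> sqrt (4 * \<tau>_max / (\<alpha>\<^sup>2 + \<alpha> * \<kappa>_min + \<tau>_max))"
      unfolding lam by (rule cmod_preconditioned_upper[OF \<alpha> k(1) Re])
  next
    have \<theta>: "(cmod \<theta>)\<^sup>2 \<le> \<tau>_max + \<beta>_max"
      unfolding \<tau>_max \<beta>_max using norm_le_lambda_max_gram by (rule cmod_bound)
    show "Re \<mu> \<le> \<kappa>_max / (2 * \<alpha>)"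
      using Re_upper \<alpha> by (simp add: Re_\<mu> \<kappa>_max divide_simps)
    have "\<bar>Im \<theta>\<bar> \<le> sqrt (\<tau>_max + \<beta>_max)"
      using abs_Im_le_cmod real_le_rsqrt[OF \<theta>] by (rule order_trans)
    then show "\<bar>Im \<mu>\<bar> \<le> sqrt (\<tau>_max + \<beta>_max) / \<alpha>"
      using \<alpha> by (simp add: Im_\<mu> divide_right_mono)
    define d where "d = \<kappa>_max\<^sup>2 + \<tau>_max + \<beta>_max"
    have "0 < \<kappa>_max\<^sup>2" "0 \<le> (cmod \<theta>)\<^sup>2"
      using k by simp_all
    then have d: "0 < d"
      unfolding d_def using \<theta> by linarith
    have "\<tau>_min * (v \<bullet> v) \<le> d * (u \<bullet> u)"
      using u_lower[OF \<theta>] by (simp add: d_def \<tau>_min \<kappa>_max add.assoc)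
    \<comment> \<open>The factor \<open>\<kappa>_min\<close> prepares for \<open>Re_lower\<close>,
      which trades |u|^2 for |v|^2, so that |v|^2 cancels at the end.\<close>
    then have "\<kappa>_min * (\<tau>_min * (v \<bullet> v)) \<le> \<kappa>_min * (d * (u \<bullet> u))"
      using k by (intro mult_left_mono) auto
    also have "\<dots> \<le> d * (2 * Re \<theta> * (v \<bullet> v))"
      using mult_left_mono[OF Re_lower less_imp_le[OF d]] by (simp add: \<kappa>_min mult.left_commute)
    finally have "\<kappa>_min * \<tau>_min * (v \<bullet> v) \<le> 2 * d * Re \<theta> * (v \<bullet> v)"
      by (simp add: mult_ac)
    then have "\<kappa>_min * \<tau>_min \<le> 2 * d * Re \<theta>"
      using v_pos by simp
    then show "\<kappa>_min * \<tau>_min / (2 * \<alpha> * (\<kappa>_max\<^sup>2 + \<tau>_max + \<beta>_max)) \<le> Re \<mu>"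
      unfolding d_def[symmetric] using \<alpha> d by (simp add: Re_\<mu> divide_simps mult_ac)
  qed
qed

end
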